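(* Let $\ell,m\in\mathbb{N}$ and $k=m/\ell$. Then there exist two sets $A,A'\subset\mathbb{N}$ with $\overline{\mathrm{d}}(A)=\frac{k+1}{k+2}=1-\frac{1}{k+2}$ and $\overline{\mathrm{d}}(A')=1-\frac{1}{\ell(k+1)(k+2)}$ such that for any infinite set $B\subset\mathbb{N}$ and any integer $t\in\mathbb{N}$ we have $$\{mb_1+\ell b_2 : b_1,b_2\in B,\ b_1\le b_2\}+t\not\subset A\quad\text{and}\quad \{mb_1+\ell b_2 : b_1,b_2\in B,\ b_1\le b_2\}\not\subset A'.$$
   Context: $\mathbb{N}=\{1,2,3,\dots\}$. The upper density of $A\subset\mathbb{N}$ is $\overline{\mathrm{d}}(A)=\limsup_{N\to\infty}\frac{|A\cap\{1,\dots,N\}|}{N}$. For a set $C$ of integers and an integer $t$, $C+t=\{c+t: c\in C\}$. *)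

theory Defs
  imports "HOL-Library.Liminf_Limsup" "HOL-Library.Extended_Real"
begin

text \<open>
  Sets of positive integers are rendered as sets of type \<^typ>\<open>nat set\<close> contained in
  \<open>{1..}\<close>. The limit superior is taken in the extended reals, where it always exists;
  the term at \<open>N = 0\<close>, which is \<open>0 / 0 = 0\<close>, does not affect it.
\<close>

definition upper_density :: "nat set \<Rightarrow> ereal" where
  "upper_density A = limsup (\<lambda>N. ereal (real (card (A \<inter> {1..N})) / real N))"

definition ordered_sums :: "nat \<Rightarrow> nat \<Rightarrow> nat set \<Rightarrow> nat set" where
  "ordered_sums m l B = {m * b1 + l * b2 | b1 b2. b1 \<in> B \<and> b2 \<in> B \<and> b1 \<le> b2}"

definition translate :: "nat set \<Rightarrow> nat \<Rightarrow> nat set" where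
  "translate C t = {c + t | c. c \<in> C}"

end

theory Submission
  imports Defs "HOL-Real_Asymp.Real_Asymp"
begin

text \<open>
  Put \<open>r = k + 1 = (m + l) / l\<close>. If the sums with summands from an infinite set \<open>B\<close>, shifted by
  \<open>t\<close>, all lie in \<open>A\<close>, fix \<open>a \<in> B\<close>, let \<open>b \<in> B\<close> be much larger, and put \<open>x = l * b\<close>. The pair
  \<open>(b, b)\<close> gives \<open>r * x + t \<in> A\<close> and the pair \<open>(a, b)\<close> gives \<open>x + (m * a + t) \<in> A\<close>. Up to bounded
  shifts, \<open>A\<close> contains both \<open>x\<close> and \<open>r * x\<close>. On the multiplicative scale this is excluded when \<open>A\<close>
  consists of the intervals from \<open>r ^ (2 * j)\<close> to \<open>r ^ (2 * j + 1)\<close>, because multiplication by \<open>r\<close>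
  exchanges these blocks with the gaps between them. To make the argument robust under bounded shifts,
  the left end of the \<open>j\<close>-th block is moved up by \<open>j\<close>, which is unbounded but negligible for the
  density (\<open>blocks_no_ordered_sums\<close>).

  For \<open>A'\<close>, all numbers that are not multiples of \<open>q = m + l\<close> are added to \<open>A\<close>. By the pigeonhole
  principle \<open>B\<close> has an infinite subset lying in one residue class modulo \<open>q\<close>; the sums from this subset
  are multiples of \<open>q\<close>, so that they would have to lie in \<open>A\<close>, and the previous case with \<open>t = 0\<close>
  applies. This step needs the unshifted sums
  (\<open>blocks_or_nonmultiples_no_ordered_sums\<close>).

  Both densities are instances of one computation: for every \<open>q \<ge> 1\<close>, the multiples of \<open>q\<close> lying in
  gaps have lower density \<open>1 / (q * (r + 1))\<close>. The proportion of such numbers is smallest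
  at the right ends of blocks. The gaps below \<open>r ^ (2 * j + 1)\<close> have lengths
  \<open>r ^ (2 * i) - r ^ (2 * i - 1)\<close> for \<open>1 \<le> i \<le> j\<close>, up to shifts; their total length is a geometric sum
  close to \<open>r ^ (2 * j + 1) / (r + 1)\<close>, and a fraction \<open>1 / q\<close> of it is counted. The accumulated errors
  are quadratic in \<open>j\<close>, hence negligible against \<open>r ^ (2 * j + 1)\<close>
  (\<open>gap_multiples_block_end\<close>, \<open>gap_multiples_lower\<close>). The set \<open>A\<close> is the case \<open>q = 1\<close>, and for \<open>A'\<close>
  one has \<open>q = m + l = l * (k + 1)\<close>.
\<close>

section \<open>Blocks in geometric progression\<close>

text \<open>
  The shift \<open>real j\<close> of the left end eventually exceeds every fixed number, so that a translation by a
  fixed amount cannot carry a number below \<open>r ^ (2 * j)\<close> into block \<open>j\<close> when \<open>j\<close> is large.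
\<close>

definition geometric_blocks :: "real \<Rightarrow> nat set" where
  "geometric_blocks r = {n. \<exists>j. r ^ (2 * j) + real j < real n \<and> real n \<le> r ^ (2 * j + 1)}"

text \<open>
  The bound \<open>x\<close> is real so that powers of \<open>r\<close> can be used as cut-off points without rounding.
\<close>

definition gap_multiples :: "nat \<Rightarrow> real \<Rightarrow> real \<Rightarrow> nat set" where
  "gap_multiples q r x = {n. 0 < n \<and> real n \<le> x \<and> q dvd n \<and> n \<notin> geometric_blocks r}"

definition blocks_or_nonmultiples :: "nat \<Rightarrow> real \<Rightarrow> nat set" where
  "blocks_or_nonmultiples q r = {n. 0 < n \<and> (q dvd n \<longrightarrow> n \<in> geometric_blocks r)}"

lemma geometric_blocks_positive:
  assumes "r > 1" "n \<in> geometric_blocks r"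
  shows "n \<ge> 1"
proof -
  obtain j where "r ^ (2 * j) + real j < real n"
    using assms(2) by (auto simp: geometric_blocks_def)
  moreover have "r ^ (2 * j) > 0" using assms(1) by simp
  ultimately have "real n > 0" by linarith
  then show ?thesis by simp
qed

section \<open>Avoiding ordered sums\<close>

text \<open>
  Multiplication by \<open>r\<close> moves blocks into gaps. If \<open>r * x + t\<close> lies in block \<open>j\<close> with \<open>j > t\<close>, then
  \<open>x\<close> lies between \<open>r ^ (2 * j - 1)\<close> and \<open>r ^ (2 * j)\<close>, in the gap below block \<open>j\<close>. Adding a constant
  smaller than \<open>j\<close> does not carry \<open>x\<close> past the shifted left end of block \<open>j\<close>.
\<close>

lemma blocks_no_ordered_sums:
  fixes l m t :: nat
  assumes "l \<ge> 1" "m \<ge> 1" and r: "r = real (m + l) / real l" and B: "infinite B"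
  shows "\<not> translate (ordered_sums m l B) t \<subseteq> geometric_blocks r"
proof
  assume sub: "translate (ordered_sums m l B) t \<subseteq> geometric_blocks r"
  have sum: "m * a + l * b + t \<in> geometric_blocks r" if "a \<in> B" "b \<in> B" "a \<le> b" for a b
    using sub that by (auto simp: translate_def ordered_sums_def)
  have r1: "r > 1" using assms(1,2) by (simp add: r field_simps)
  obtain a where a: "a \<in> B" using B by fastforce
  define c where "c = m * a + t"
  \<comment> \<open>With this lower bound on \<open>b\<close>, the block that contains \<open>(m + l) * b + t\<close> has an index above \<open>c\<close>.\<close>
  obtain b where b: "b \<in> B" "b > a + nat \<lceil>r ^ (2 * c + 1)\<rceil>"
    using B by (meson infinite_nat_iff_unbounded)
  define x where "x = real (l * b)"
  have rx: "r * x = real ((m + l) * b)"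
    using assms by (simp add: x_def r)
  have "m * b + l * b + t \<in> geometric_blocks r" using sum b by blast
  then obtain j where j: "r ^ (2 * j) + real j < r * x + real t" "r * x + real t \<le> r ^ (2 * j + 1)"
    unfolding rx by (auto simp: geometric_blocks_def algebra_simps)
  have "r ^ (2 * c + 1) < real b" using b(2) by linarith
  also have "real b \<le> r * x"
  proof -
    have "1 * b \<le> (m + l) * b" using assms by (intro mult_right_mono) auto
    then show ?thesis unfolding rx by (metis mult_1 of_nat_le_iff)
  qed
  also have "\<dots> \<le> r ^ (2 * j + 1)" using j(2) by linarith
  finally have "2 * c + 1 < 2 * j + 1" using r1 power_strict_increasing_iff by blast
  then have cj: "c < j" by simp
  then obtain i where i: "j = Suc i" by (cases j) auto
  have tc: "real t \<le> real c" by (simp add: c_def)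
  \<comment> \<open>The two estimates \<open>lo\<close> and \<open>hi\<close> place \<open>x\<close> in the gap between block \<open>i = j - 1\<close> and block \<open>j\<close>.\<close>
  have lo: "r ^ (2 * i + 1) < x"
  proof -
    have "r * r ^ (2 * i + 1) < r * x"
      using j(1) cj tc by (simp add: i)
    then show ?thesis using r1 by (simp del: power_Suc)
  qed
  have hi: "x \<le> r ^ (2 * j)"
  proof -
    have "r * x \<le> r * r ^ (2 * j)" using j(2) by simp
    then show ?thesis using r1 by simp
  qed
  have "m * a + l * b + t \<in> geometric_blocks r" using sum a b by simp
  then obtain j' where j': "r ^ (2 * j') + real j' < x + real c" "x + real c \<le> r ^ (2 * j' + 1)"
    by (auto simp: geometric_blocks_def algebra_simps x_def c_def)
  have "r ^ (2 * i + 1) < r ^ (2 * j' + 1)" using lo j'(2) by linarith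
  then have "2 * i + 1 < 2 * j' + 1" using r1 power_strict_increasing_iff by blast
  then have jj: "j \<le> j'" using i by simp
  then have "r ^ (2 * j) \<le> r ^ (2 * j')" using r1 by (intro power_increasing) auto
  then show False using j'(1) hi jj cj by linarith
qed

text \<open>
  If \<open>a\<close> and \<open>b\<close> are congruent modulo \<open>m + l\<close>, then \<open>m * a + l * b\<close> is congruent to \<open>(m + l) * a\<close>,
  hence divisible by \<open>m + l\<close>. On a single residue class the added non-multiples are therefore of no help.
\<close>

lemma blocks_or_nonmultiples_no_ordered_sums:
  fixes l m :: nat
  assumes "l \<ge> 1" "m \<ge> 1" and r: "r = real (m + l) / real l" and B: "infinite B"
  shows "\<not> ordered_sums m l B \<subseteq> blocks_or_nonmultiples (m + l) r"
proof
  assume sub: "ordered_sums m l B \<subseteq> blocks_or_nonmultiples (m + l) r"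
  let ?q = "m + l"
  have "(\<lambda>b. b mod ?q) ` B \<subseteq> {..<?q}" using assms by auto
  then have "finite ((\<lambda>b. b mod ?q) ` B)" using finite_subset by blast
  then obtain b0 where "b0 \<in> B" and inf: "infinite {b \<in> B. b mod ?q = b0 mod ?q}"
    using pigeonhole_infinite[OF B] by blast
  define B' where "B' = {b \<in> B. b mod ?q = b0 mod ?q}"
  have "translate (ordered_sums m l B') 0 \<subseteq> geometric_blocks r"
  proof
    fix n assume "n \<in> translate (ordered_sums m l B') 0"
    then obtain a b where ab: "n = m * a + l * b" "a \<in> B'" "b \<in> B'" "a \<le> b"
      by (auto simp: translate_def ordered_sums_def)
    then have "a mod ?q = b mod ?q" by (simp add: B'_def)
    then have "?q dvd b - a" using ab(4) by (metis mod_eq_dvd_iff_nat)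
    moreover have "n = ?q * a + l * (b - a)"
    proof -
      have "l * b = l * a + l * (b - a)" using ab(4) by (metis distrib_left le_add_diff_inverse)
      then show ?thesis using ab(1) by (simp add: algebra_simps)
    qed
    ultimately have "?q dvd n" by simp
    moreover have "n \<in> ordered_sums m l B" using ab by (auto simp: ordered_sums_def B'_def)
    ultimately show "n \<in> geometric_blocks r" using sub by (auto simp: blocks_or_nonmultiples_def)
  qed
  then show False using blocks_no_ordered_sums[OF assms(1,2) r] inf unfolding B'_def by blast
qed

section \<open>Counting multiples in the gaps\<close>

lemma card_multiples_between:
  fixes a b :: real and q :: nat
  assumes "q \<ge> 1" "0 \<le> a" "a \<le> b"
  shows "\<bar>real (card {n. a < real n \<and> real n \<le> b \<and> q dvd n}) - (b - a) / real q\<bar> \<le> 1"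
proof -
  have q: "real q > 0" using assms(1) by simp
  have "{n. a < real n \<and> real n \<le> b \<and> q dvd n}
      = (*) q ` {nat \<lfloor>a / real q\<rfloor> <.. nat \<lfloor>b / real q\<rfloor>}" (is "?L = ?R")
  proof (intro set_eqI)
    have mem: "a < real (q * i) \<and> real (q * i) \<le> b
        \<longleftrightarrow> i \<in> {nat \<lfloor>a / real q\<rfloor> <.. nat \<lfloor>b / real q\<rfloor>}" for i
    proof -
      have "a < real (q * i) \<longleftrightarrow> a / real q < real i"
        using q by (simp add: field_simps)
      also have "\<dots> \<longleftrightarrow> nat \<lfloor>a / real q\<rfloor> < i"
        using assms q by (auto simp: nat_less_iff floor_less_iff)
      finally have 1: "a < real (q * i) \<longleftrightarrow> nat \<lfloor>a / real q\<rfloor> < i" .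
      have "real (q * i) \<le> b \<longleftrightarrow> real i \<le> b / real q"
        using q by (simp add: field_simps)
      also have "\<dots> \<longleftrightarrow> i \<le> nat \<lfloor>b / real q\<rfloor>"
        using assms q by (simp add: le_nat_floor le_nat_iff le_floor_iff)
      finally show ?thesis using 1 by simp
    qed
    fix n show "n \<in> ?L \<longleftrightarrow> n \<in> ?R"
    proof (cases "q dvd n")
      case True
      then obtain i where "n = q * i" by (rule dvdE)
      then show ?thesis using mem[of i] assms(1) by (simp add: image_iff)
    next
      case False
      then have "n \<notin> ?R" by (metis dvd_triv_left imageE)
      then show ?thesis using False by blast
    qed
  qed
  moreover have "inj ((*) q)" using assms(1) by (intro injI) simp
  ultimately have "card ?L = nat \<lfloor>b / real q\<rfloor> - nat \<lfloor>a / real q\<rfloor>"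
    by (simp add: card_image inj_on_subset)
  moreover have "\<lfloor>a / real q\<rfloor> \<le> \<lfloor>b / real q\<rfloor>" "0 \<le> \<lfloor>a / real q\<rfloor>"
    using assms q by (auto intro!: floor_mono divide_right_mono)
  ultimately have "real (card ?L) = real_of_int \<lfloor>b / real q\<rfloor> - real_of_int \<lfloor>a / real q\<rfloor>"
    by (simp add: nat_mono del: zero_le_floor)
  then show ?thesis unfolding diff_divide_distrib by linarith
qed

lemma finite_gap_multiples: "finite (gap_multiples q r x)"
proof (rule finite_subset)
  show "gap_multiples q r x \<subseteq> {..nat \<lfloor>x\<rfloor>}"
    by (auto simp: gap_multiples_def le_nat_floor)
qed simp

lemma finite_real_interval_multiples: "finite {n. a < real n \<and> real n \<le> b \<and> q dvd n}"
proof (rule finite_subset)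
  show "{n. a < real n \<and> real n \<le> b \<and> q dvd n} \<subseteq> {..nat \<lfloor>b\<rfloor>}"
    by (auto simp: le_nat_floor)
qed simp

text \<open>
  Between the end of block \<open>j\<close> and \<open>r ^ (2 * j + 2)\<close> there is no element of any block, whatever the
  shifts are, so all multiples of \<open>q\<close> there are counted.
\<close>

lemma gap_multiples_step_lower:
  assumes "q \<ge> 1" "r > 1" "r ^ (2 * j + 1) \<le> y" "y \<le> r ^ (2 * j + 2)" "y \<le> x"
  shows "real (card (gap_multiples q r x))
    \<ge> real (card (gap_multiples q r (r ^ (2 * j + 1)))) + (y - r ^ (2 * j + 1)) / real q - 1"
proof -
  let ?p = "r ^ (2 * j + 1)"
  let ?M = "{n. ?p < real n \<and> real n \<le> y \<and> q dvd n}"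
  have p: "?p > 0" using assms(2) by simp
  have "n \<notin> geometric_blocks r" if "?p < real n" "real n \<le> r ^ (2 * j + 2)" for n
  proof
    assume "n \<in> geometric_blocks r"
    then obtain i where i: "r ^ (2 * i) + real i < real n" "real n \<le> r ^ (2 * i + 1)"
      by (auto simp: geometric_blocks_def)
    have "?p < r ^ (2 * i + 1)" "r ^ (2 * i) < r ^ (2 * j + 2)" using i that by linarith+
    then have "2 * j + 1 < 2 * i + 1" "2 * i < 2 * j + 2"
      using assms(2) power_strict_increasing_iff by blast+
    then show False by simp
  qed
  then have "gap_multiples q r ?p \<union> ?M \<subseteq> gap_multiples q r x"
    using assms(3-5) p by (fastforce simp: gap_multiples_def simp del: power_Suc intro!: gr0I)
  moreover have "gap_multiples q r ?p \<inter> ?M = {}" by (auto simp: gap_multiples_def)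
  ultimately have "card (gap_multiples q r ?p) + card ?M \<le> card (gap_multiples q r x)"
    by (metis card_Un_disjoint card_mono finite_gap_multiples finite_real_interval_multiples)
  then have "real (card (gap_multiples q r ?p)) + real (card ?M) \<le> real (card (gap_multiples q r x))"
    by linarith
  then show ?thesis
    using card_multiples_between[of q ?p y] assms p by linarith
qed

text \<open>
  Above \<open>r ^ (2 * j + 2) + (j + 1)\<close> and up to \<open>r ^ (2 * j + 3)\<close> everything lies in block \<open>j + 1\<close>; this
  range may be empty for small \<open>j\<close>, which does no harm to an upper bound. The terms \<open>j + 2\<close> are the shift
  \<open>j + 1\<close> of the left end plus a rounding error of \<open>1\<close>.
\<close>

lemma gap_multiples_step_upper:
  assumes "q \<ge> 1" "r > 1"
  shows "real (card (gap_multiples q r (r ^ (2 * j + 3))))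
    \<le> real (card (gap_multiples q r (r ^ (2 * j + 1))))
       + (r ^ (2 * j + 2) - r ^ (2 * j + 1)) / real q + real j + 2"
proof -
  let ?p = "r ^ (2 * j + 1)"
  let ?y = "r ^ (2 * j + 2) + real (j + 1)"
  let ?M = "{n. ?p < real n \<and> real n \<le> ?y \<and> q dvd n}"
  have p: "?p > 0" using assms(2) by simp
  have py: "?p \<le> r ^ (2 * j + 2)" using assms(2) by (intro power_increasing) auto
  have "n \<in> geometric_blocks r" if "?y < real n" "real n \<le> r ^ (2 * j + 3)" for n
    unfolding geometric_blocks_def using that
    by (auto intro!: exI[of _ "j + 1"] simp: numeral_3_eq_3)
  then have "gap_multiples q r (r ^ (2 * j + 3)) \<subseteq> gap_multiples q r ?p \<union> ?M"
    by (auto simp: gap_multiples_def not_le)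
  then have "card (gap_multiples q r (r ^ (2 * j + 3))) \<le> card (gap_multiples q r ?p \<union> ?M)"
    by (intro card_mono finite_UnI finite_gap_multiples finite_real_interval_multiples)
  also have "\<dots> \<le> card (gap_multiples q r ?p) + card ?M" by (rule card_Un_le)
  finally have "real (card (gap_multiples q r (r ^ (2 * j + 3))))
      \<le> real (card (gap_multiples q r ?p)) + real (card ?M)" by linarith
  also have "real (card ?M) \<le> (?y - ?p) / real q + 1"
    using card_multiples_between[of q ?p ?y] assms(1) p py by linarith
  also have "(?y - ?p) / real q = (r ^ (2 * j + 2) - ?p) / real q + real (j + 1) / real q"
    by (simp add: add_divide_distrib diff_divide_distrib)
  also have "real (j + 1) / real q \<le> real (j + 1)"
    using assms(1) by (simp add: divide_le_eq mult_le_cancel_left1)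
  finally show ?thesis by simp
qed

text \<open>
  The main term \<open>r ^ (2 * j + 1) / (q * (r + 1))\<close> is exactly compatible with the passage from one block
  to the next, since \<open>r ^ (2 * j + 1) / (r + 1) + (r ^ (2 * j + 2) - r ^ (2 * j + 1)) =
  r ^ (2 * j + 3) / (r + 1)\<close>. Only the error of at most \<open>j + 2\<close> per step accumulates, and
  \<open>(j + 2)\<^sup>2 + r\<close> is a convenient bound for it that also covers the initial block.
\<close>

lemma gap_multiples_block_end:
  assumes "q \<ge> 1" "r > 1"
  shows "\<bar>real (card (gap_multiples q r (r ^ (2 * j + 1)))) - r ^ (2 * j + 1) / (real q * (r + 1))\<bar>
    \<le> (real j + 2)\<^sup>2 + r"
proof (induction j)
  case 0
  have "gap_multiples q r r \<subseteq> {n. 0 < real n \<and> real n \<le> r \<and> 1 dvd n}"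
    by (auto simp: gap_multiples_def)
  then have "card (gap_multiples q r r) \<le> card {n. 0 < real n \<and> real n \<le> r \<and> 1 dvd n}"
    by (intro card_mono finite_real_interval_multiples)
  moreover have "real (card {n. 0 < real n \<and> real n \<le> r \<and> 1 dvd n}) \<le> r + 1"
    using card_multiples_between[of 1 0 r] assms by simp
  ultimately have "real (card (gap_multiples q r r)) \<le> r + 1" by linarith
  moreover have "r / (real q * (r + 1)) \<le> r"
  proof -
    have "1 * 1 \<le> real q * (r + 1)" using assms by (intro mult_mono) auto
    then show ?thesis using assms(2) by (simp add: divide_le_eq mult_le_cancel_left1)
  qed
  moreover have "0 \<le> r / (real q * (r + 1))" using assms by simp
  ultimately show ?case by simp
next
  case (Suc j)
  let ?c = "real q * (r + 1)"
  have c: "real q > 0" "r + 1 > 0" using assms by auto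
  have tele: "r ^ (2 * j + 1) / ?c + (r ^ (2 * j + 2) - r ^ (2 * j + 1)) / real q = r ^ (2 * j + 3) / ?c"
    using c by (simp add: divide_simps) (simp add: algebra_simps numeral_3_eq_3)
  have "r ^ (2 * j + 1) \<le> r ^ (2 * j + 2)" "r ^ (2 * j + 2) \<le> r ^ (2 * j + 3)"
    using assms by (intro power_increasing; simp)+
  note lower = gap_multiples_step_lower[OF assms this(1) order.refl this(2)]
  note upper = gap_multiples_step_upper[OF assms, of j]
  have sq: "(real (Suc j) + 2)\<^sup>2 \<ge> (real j + 2)\<^sup>2 + real j + 2"
    by (simp add: power2_eq_square algebra_simps)
  have "2 * Suc j + 1 = 2 * j + 3" by simp
  then show ?case using Suc.IH lower upper tele sq by (simp only:)
qed

text \<open>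
  Within a period the proportion of counted numbers first rises along the gap and then falls along the
  block, so it is bounded below by its values at the two block ends. With \<open>y\<close> the point up to which
  the gap has been traversed, both phases are handled by the step estimate.
\<close>

lemma gap_multiples_lower:
  assumes "q \<ge> 1" "r > 1" "r ^ (2 * j + 1) \<le> x" "x \<le> r ^ (2 * j + 3)"
  shows "real (card (gap_multiples q r x)) \<ge> x / (real q * (r + 1)) - (real j + 2)\<^sup>2 - r - 1"
proof -
  let ?c = "real q * (r + 1)"
  let ?p = "r ^ (2 * j + 1)"
  have c: "real q > 0" "r + 1 > 0" using assms by auto
  have pp: "?p \<le> r ^ (2 * j + 2)" using assms by (intro power_increasing; simp)
  define y where "y = min x (r ^ (2 * j + 2))"
  have "x / ?c \<le> ?p / ?c + (y - ?p) / real q"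
  proof (cases "x \<le> r ^ (2 * j + 2)")
    case True
    have "(x - ?p) / ?c \<le> (x - ?p) / real q"
      using assms c by (intro divide_left_mono) (auto simp: mult_le_cancel_left1)
    then show ?thesis using True by (simp add: y_def diff_divide_distrib)
  next
    case False
    have "?p / ?c + (r ^ (2 * j + 2) - ?p) / real q = r ^ (2 * j + 3) / ?c"
      using c by (simp add: divide_simps) (simp add: algebra_simps numeral_3_eq_3)
    moreover have "x / ?c \<le> r ^ (2 * j + 3) / ?c"
      using assms(4) c by (intro divide_right_mono) auto
    ultimately show ?thesis using False by (simp add: y_def)
  qed
  moreover have "real (card (gap_multiples q r x))
      \<ge> real (card (gap_multiples q r ?p)) + (y - ?p) / real q - 1"
    using assms pp by (intro gap_multiples_step_lower) (auto simp: y_def)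
  ultimately show ?thesis using gap_multiples_block_end[OF assms(1,2), of j] by linarith
qed

section \<open>The upper density\<close>

lemma card_blocks_or_nonmultiples:
  "real (card (blocks_or_nonmultiples q r \<inter> {1..N})) = real N - real (card (gap_multiples q r (real N)))"
proof -
  have "{1..N} = (blocks_or_nonmultiples q r \<inter> {1..N}) \<union> gap_multiples q r (real N)"
    by (auto simp: blocks_or_nonmultiples_def gap_multiples_def)
  moreover have "(blocks_or_nonmultiples q r \<inter> {1..N}) \<inter> gap_multiples q r (real N) = {}"
    by (auto simp: blocks_or_nonmultiples_def gap_multiples_def)
  ultimately have "card {1..N} = card (blocks_or_nonmultiples q r \<inter> {1..N}) + card (gap_multiples q r (real N))"
    by (metis card_Un_disjoint finite_Int finite_atLeastAtMost finite_gap_multiples)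
  then show ?thesis by simp
qed

lemma error_eventually_small:
  assumes "r > 1" "e > 0"
  shows "\<forall>\<^sub>F j in sequentially. (real j + 2)\<^sup>2 + r + 1 \<le> e * (r ^ (2 * j + 1) - 1)"
proof -
  have "filterlim (\<lambda>j. ((real j + 2)\<^sup>2 + r + 1) / (r ^ (2 * j + 1) - 1)) (nhds 0) sequentially"
    using assms(1) by real_asymp
  then have "\<forall>\<^sub>F j in sequentially. ((real j + 2)\<^sup>2 + r + 1) / (r ^ (2 * j + 1) - 1) < e"
    using assms(2) by (rule order_tendstoD(2))
  then show ?thesis
  proof eventually_elim
    case (elim j)
    have "r ^ (2 * j + 1) > 1" using assms(1) by (intro one_less_power) auto
    then show ?case using elim by (simp add: pos_divide_less_eq less_imp_le)
  qed
qed

lemma limsup_eqI: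
  fixes f :: "nat \<Rightarrow> real"
  assumes upper: "\<And>e. e > 0 \<Longrightarrow> \<forall>\<^sub>F n in sequentially. f n \<le> L + e"
    and lower: "\<And>e. e > 0 \<Longrightarrow> \<exists>\<^sub>F n in sequentially. f n \<ge> L - e"
  shows "limsup (\<lambda>n. ereal (f n)) = ereal L"
proof (rule antisym)
  show "limsup (\<lambda>n. ereal (f n)) \<le> ereal L"
  proof (rule ereal_le_epsilon2)
    fix e :: real assume "0 < e"
    then show "limsup (\<lambda>n. ereal (f n)) \<le> ereal L + ereal e"
      using upper[of e] by (intro Limsup_bounded) auto
  qed
next
  show "ereal L \<le> limsup (\<lambda>n. ereal (f n))"
  proof (rule ereal_le_epsilon2)
    fix e :: real assume e: "0 < e"
    have "ereal (L - e) \<le> limsup (\<lambda>n. ereal (f n))"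
    proof (rule ccontr)
      assume "\<not> ?thesis"
      then have "\<forall>\<^sub>F n in sequentially. ereal (f n) < ereal (L - e)"
        by (intro Limsup_lessD) simp
      then show False using lower[OF e] by (auto simp: frequently_def not_le)
    qed
    then show "ereal L \<le> limsup (\<lambda>n. ereal (f n)) + ereal e"
      by (cases "limsup (\<lambda>n. ereal (f n))") auto
  qed
qed

lemma ex_odd_power_interval:
  fixes r x :: real
  assumes "r > 1" "x \<ge> r ^ (2 * J + 1)"
  obtains j where "J \<le> j" "r ^ (2 * j + 1) \<le> x" "x < r ^ (2 * j + 3)"
proof -
  let ?P = "\<lambda>j. x < r ^ (2 * j + 3)"
  obtain n where n: "x < r ^ n" using real_arch_pow[OF assms(1)] by blast
  also have "\<dots> \<le> r ^ (2 * n + 3)" using assms(1) by (intro power_increasing) auto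
  finally have ex: "\<exists>j. J \<le> j \<and> ?P j"
  proof -
    assume "x < r ^ (2 * n + 3)"
    moreover have "r ^ (2 * n + 3) \<le> r ^ (2 * (max n J) + 3)"
      using assms(1) by (intro power_increasing) auto
    ultimately show ?thesis by (intro exI[of _ "max n J"]) auto
  qed
  define j where "j = (LEAST j. J \<le> j \<and> ?P j)"
  have j: "J \<le> j" "?P j" using LeastI_ex[OF ex] by (auto simp: j_def)
  have "r ^ (2 * j + 1) \<le> x"
  proof (cases "j = J")
    case False
    then obtain i where i: "j = Suc i" "J \<le> i" using j(1) by (cases j) auto
    then have "\<not> ?P i" using not_less_Least[of i "\<lambda>j. J \<le> j \<and> ?P j"] by (simp add: j_def)
    then show ?thesis by (simp add: i(1) numeral_3_eq_3)
  qed (use assms in simp)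
  then show ?thesis using that j by blast
qed

text \<open>
  The upper bound on the limit superior holds at every large \<open>N\<close>, by the lower bound on the count inside
  the period that contains \<open>N\<close>. It is approached along the right ends of the blocks.
\<close>

lemma upper_density_blocks_or_nonmultiples:
  assumes "q \<ge> 1" "r > 1"
  shows "upper_density (blocks_or_nonmultiples q r) = ereal (1 - 1 / (real q * (r + 1)))"
  unfolding upper_density_def card_blocks_or_nonmultiples
proof (rule limsup_eqI)
  let ?c = "1 / (real q * (r + 1))"
  let ?C = "\<lambda>x. real (card (gap_multiples q r x))"
  have "1 * 1 \<le> real q * (r + 1)" using assms by (intro mult_mono) auto
  then have c: "0 \<le> ?c" "?c \<le> 1" by auto
  fix e :: real assume e: "e > 0"
  obtain J where J: "(real j + 2)\<^sup>2 + r + 1 \<le> e * (r ^ (2 * j + 1) - 1)" if "j \<ge> J" for j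
    using error_eventually_small[OF assms(2) e] by (auto simp: eventually_sequentially)
  show "\<forall>\<^sub>F N in sequentially. (real N - ?C (real N)) / real N \<le> 1 - ?c + e"
    using eventually_ge_at_top[of "nat \<lceil>r ^ (2 * J + 1)\<rceil>"]
  proof eventually_elim
    case (elim N)
    then have "real N \<ge> r ^ (2 * J + 1)" by linarith
    then obtain j where j: "J \<le> j" "r ^ (2 * j + 1) \<le> real N" "real N < r ^ (2 * j + 3)"
      using ex_odd_power_interval[OF assms(2)] by metis
    have "r ^ (2 * j + 1) > 0" using assms(2) by simp
    then have N: "real N > 0" using j(2) by linarith
    have "e * (r ^ (2 * j + 1) - 1) \<le> e * real N" using j(2) e by (intro mult_left_mono) auto
    moreover have "?C (real N) \<ge> real N * ?c - (real j + 2)\<^sup>2 - r - 1"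
      using gap_multiples_lower[OF assms j(2)] j(3) by simp
    ultimately have "real N - ?C (real N) \<le> (1 - ?c + e) * real N"
      using J[OF j(1)] by (simp add: algebra_simps)
    then show ?case using N by (simp add: pos_divide_le_eq)
  qed
  show "\<exists>\<^sub>F N in sequentially. (real N - ?C (real N)) / real N \<ge> 1 - ?c - e"
    unfolding frequently_sequentially
  proof
    fix M :: nat
    have "filterlim (\<lambda>j::nat. r ^ (2 * j + 1)) at_top sequentially"
      using assms(2) by real_asymp
    then obtain j where j: "j \<ge> J" "r ^ (2 * j + 1) \<ge> real M + 1"
      by (metis (no_types, lifting) eventually_sequentially filterlim_at_top nle_le)
    \<comment> \<open>Rounding the block end down to an integer costs at most \<open>1\<close>, both in the count
      and in the denominator; the latter is why the error is compared with \<open>r ^ (2 * j + 1) - 1\<close>.\<close>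
    define N where "N = nat \<lfloor>r ^ (2 * j + 1)\<rfloor>"
    have N: "real N \<le> r ^ (2 * j + 1)" "r ^ (2 * j + 1) < real N + 1"
      using j(2) unfolding N_def by linarith+
    have "gap_multiples q r (real N) = gap_multiples q r (r ^ (2 * j + 1))"
      using N by (auto simp: gap_multiples_def)
    then have "?C (real N) \<le> r ^ (2 * j + 1) * ?c + (real j + 2)\<^sup>2 + r"
      using gap_multiples_block_end[OF assms, of j] by simp
    also have "r ^ (2 * j + 1) * ?c \<le> (real N + 1) * ?c"
      using N c by (intro mult_right_mono) auto
    also have "\<dots> \<le> real N * ?c + 1" using c by (simp only: distrib_right)
    finally have "?C (real N) \<le> real N * ?c + e * (r ^ (2 * j + 1) - 1)"
      using J[OF j(1)] by linarith
    also have "e * (r ^ (2 * j + 1) - 1) \<le> e * real N" using N e by (intro mult_left_mono) auto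
    finally have "(1 - ?c - e) * real N \<le> real N - ?C (real N)" by (simp add: algebra_simps)
    moreover have "N \<ge> M" "real N > 0" using N j(2) by linarith+
    ultimately show "\<exists>N\<ge>M. (real N - ?C (real N)) / real N \<ge> 1 - ?c - e"
      by (intro exI[of _ N]) (simp add: pos_le_divide_eq)
  qed
qed

section \<open>The two sets\<close>

theorem proposition5p1:
  fixes l m :: nat and k :: real
  assumes "l \<ge> 1" and "m \<ge> 1" and "k = real m / real l"
  shows "(k + 1) / (k + 2) = 1 - 1 / (k + 2) \<and>
    (\<exists>A A' :: nat set. A \<subseteq> {1..} \<and> A' \<subseteq> {1..} \<and>
      upper_density A = ereal ((k + 1) / (k + 2)) \<and>
      upper_density A' = ereal (1 - 1 / (real l * (k + 1) * (k + 2))) \<and>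
      (\<forall>(B :: nat set) (t :: nat). B \<subseteq> {1..} \<longrightarrow> infinite B \<longrightarrow> t \<ge> 1 \<longrightarrow>
        \<not> translate (ordered_sums m l B) t \<subseteq> A \<and>
        \<not> ordered_sums m l B \<subseteq> A'))"
proof -
  define r where "r = k + 1"
  have k: "k > 0" using assms by simp
  then have r1: "r > 1" by (simp add: r_def)
  have r: "r = real (m + l) / real l" using assms by (simp add: r_def field_simps)
  have q: "real (m + l) = real l * (k + 1)" using assms by (simp add: field_simps)
  have ratio: "(k + 1) / (k + 2) = 1 - 1 / (k + 2)" using k by (simp add: field_simps)
  let ?A = "geometric_blocks r" and ?A' = "blocks_or_nonmultiples (m + l) r"
  have "?A = blocks_or_nonmultiples 1 r"
    using geometric_blocks_positive[OF r1] by (force simp: blocks_or_nonmultiples_def)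
  then have "upper_density ?A = ereal ((k + 1) / (k + 2))"
    using upper_density_blocks_or_nonmultiples[of 1 r] r1 ratio by (simp add: r_def add.assoc)
  moreover have "upper_density ?A' = ereal (1 - 1 / (real l * (k + 1) * (k + 2)))"
    using upper_density_blocks_or_nonmultiples[of "m + l" r] r1 assms(1) unfolding q
    by (simp add: r_def add.assoc)
  moreover have "?A \<subseteq> {1..}" "?A' \<subseteq> {1..}"
    using geometric_blocks_positive[OF r1] by (auto simp: blocks_or_nonmultiples_def Suc_le_eq)
  ultimately have "?A \<subseteq> {1..} \<and> ?A' \<subseteq> {1..} \<and>
      upper_density ?A = ereal ((k + 1) / (k + 2)) \<and>
      upper_density ?A' = ereal (1 - 1 / (real l * (k + 1) * (k + 2))) \<and>
      (\<forall>B t. B \<subseteq> {1..} \<longrightarrow> infinite B \<longrightarrow> t \<ge> 1 \<longrightarrow>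
        \<not> translate (ordered_sums m l B) t \<subseteq> ?A \<and> \<not> ordered_sums m l B \<subseteq> ?A')"
    using blocks_no_ordered_sums[OF assms(1,2) r]
      blocks_or_nonmultiples_no_ordered_sums[OF assms(1,2) r] by simp
  then show ?thesis by (intro conjI[OF ratio] exI)
qed

end
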